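(* Let $U_2>0$, $\Delta x>0$, $\Delta t>0$, and set $\mu=\frac{2(\Delta x)^3}{U_2\,\Delta t}$. For $z\in\mathbb{C}$ with $|z|>1$, put $p=p(z)=\mu\,\frac{z-1}{z+1}$ and consider the cubic equation in $r$ $$r^3-3r^2+(3+p)\,r-1=0.$$ Then the continuous roots $\ell_1,\ell_2,\ell_3$ of this equation (in the sense defined in the context) are well separated: for every $\rho>1$, they can be numbered, independently of the angle $\theta$, in such a way that for all $z=\rho e^{i\theta}$, $\theta\in[0,2\pi)$, $$|\ell_1(z)|<1,\qquad |\ell_2(z)|>1,\qquad |\ell_3(z)|>1.$$
   Context: Continuous roots: for $\rho>1$ and $z=\rho e^{i\theta}$ with $\theta\in[0,2\pi)$, the continuous roots are functions $\ell_1,\ell_2,\ell_3$ such that $\theta\mapsto \ell_k(\rho e^{i\theta})$ is continuous on $[0,2\pi)$ for each $k$ and such that, for each $\theta$, the values $\ell_1(z),\ell_2(z),\ell_3(z)$ are the three roots, counted with multiplicity, of the equation with parameter $z=\rho e^{i\theta}$. (Such a continuous choice of the roots along the interval always exists.) The assertion holds for any such choice. *)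

theory Defs
  imports
    "HOL-Analysis.Analysis"
    "HOL-Computational_Algebra.Computational_Algebra"
    "HOL-Combinatorics.Permutations"
begin

definition mu :: "real \<Rightarrow> real \<Rightarrow> real \<Rightarrow> real"
  where "mu U2 dx dt = 2 * dx ^ 3 / (U2 * dt)"

definition p_of :: "real \<Rightarrow> complex \<Rightarrow> complex"
  where "p_of \<mu> z = of_real \<mu> * ((z - 1) / (z + 1))"

text \<open>Coefficients are listed from the constant term upwards.\<close>

definition char_cubic :: "real \<Rightarrow> complex \<Rightarrow> complex poly"
  where "char_cubic \<mu> z = [:- 1, 3 + p_of \<mu> z, - 3, 1:]"

text \<open>
  A family \<open>l 1\<close>, \<open>l 2\<close>, \<open>l 3\<close> of roots along the circle of radius \<open>\<rho>\<close>.  Continuity is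
  required in the angle on the half-open interval only: the values as \<open>\<theta>\<close> tends to \<open>2 * pi\<close>
  need not match those at \<open>\<theta> = 0\<close>.  The multiset equation says that the three values are the
  roots counted with multiplicity.
\<close>

definition continuous_roots :: "real \<Rightarrow> real \<Rightarrow> (nat \<Rightarrow> complex \<Rightarrow> complex) \<Rightarrow> bool"
  where "continuous_roots \<mu> \<rho> l \<longleftrightarrow>
    (\<forall>k\<in>{1, 2, 3}. continuous_on {0..<2 * pi} (\<lambda>\<theta>. l k (rcis \<rho> \<theta>))) \<and>
    (\<forall>\<theta>\<in>{0..<2 * pi}.
       {# l 1 (rcis \<rho> \<theta>), l 2 (rcis \<rho> \<theta>), l 3 (rcis \<rho> \<theta>) #}
         = proots (char_cubic \<mu> (rcis \<rho> \<theta>)))"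

end

theory Submission
  imports Defs
begin

text \<open>
  The equation reads \<open>(r - 1)\<^sup>3 + p r = 0\<close>, and \<open>Re p > 0\<close> for \<open>\<bar>z\<bar> > 1\<close>.  On the unit
  circle \<open>(r - 1)\<^sup>2 / r\<close> is the real number \<open>2 Re r - 2\<close>, which forces
  \<open>p = (2 - 2 Re r) (r - 1)\<close>, hence \<open>Re p \<le> 0\<close>; so no root ever meets the unit circle and
  each continuous root stays on its side of it.  It remains to look at \<open>\<theta> = 0\<close>, where \<open>p\<close>
  is real and positive: there is a real root \<open>a\<close> in \<open>(0, 1)\<close>, and the other two are conjugate
  with squared modulus \<open>1 / a\<close>.
\<close>

text \<open>Multiplying numerator and denominator by \<open>cnj (z + 1)\<close> gives real part
  \<open>((norm z)\<^sup>2 - 1) / (norm (z + 1))\<^sup>2\<close>.\<close>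

lemma Re_Moebius_pos:
  assumes "norm z > 1"
  shows "Re ((z - 1) / (z + 1)) > 0"
proof -
  have ne: "z + 1 \<noteq> 0"
    using assms by (metis add_eq_0_iff less_irrefl norm_minus_cancel norm_one)
  have "1 < (norm z)\<^sup>2"
    using assms by (simp add: one_less_power)
  then have "(Re z - 1) * (Re z + 1) + Im z * Im z > 0"
    unfolding cmod_power2 by (simp add: power2_eq_square algebra_simps)
  moreover have "(Re z + 1)\<^sup>2 + (Im z)\<^sup>2 > 0"
    using ne by (auto simp: complex_eq_iff sum_power2_gt_zero_iff add_eq_0_iff)
  ultimately show ?thesis
    by (simp add: Re_divide)
qed

lemma poly_char_cubic: "poly (char_cubic \<mu> z) r = (r - 1) ^ 3 + p_of \<mu> z * r"
  by (simp add: char_cubic_def power3_eq_cube algebra_simps)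

lemma char_cubic_neq_0: "char_cubic \<mu> z \<noteq> 0"
  by (simp add: char_cubic_def)

lemma cubic_root_not_on_circle:
  assumes "Re p > 0" and root: "(r - 1) ^ 3 + p * r = 0"
  shows "norm r \<noteq> 1"
proof
  assume "norm r = 1"
  then have inv: "r * cnj r = 1"
    by (simp add: complex_norm_square[symmetric])
  have real: "r + cnj r = of_real (2 * Re r)"
    by (rule complex_add_cnj)
  \<comment> \<open>The factor \<open>r * cnj r = 1\<close> is inserted so that the root equation
    can replace \<open>p * r\<close>; the remaining \<open>cnj r\<close> acts as
    \<open>1 / r\<close>.\<close>
  have "p = p * r * cnj r"
    using inv by (simp add: mult.assoc)
  also have "p * r = - ((r - 1) ^ 3)"
    using root by (simp add: eq_neg_iff_add_eq_0 add.commute)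
  also have "- ((r - 1) ^ 3) * cnj r = (2 - (r + cnj r)) * (r - 1)"
    using inv by algebra
  finally have "p = of_real (2 - 2 * Re r) * (r - 1)"
    using real by simp
  then have "Re p = (2 - 2 * Re r) * (Re r - 1)"
    by (simp flip: scaleR_conv_of_real)
  then have "Re p = - 2 * (Re r - 1)\<^sup>2"
    by (simp add: power2_eq_square algebra_simps)
  with \<open>Re p > 0\<close> show False
    by (smt (verit) zero_le_power2)
qed

lemma real_cubic_root_in_unit_interval:
  fixes p :: real
  assumes "p > 0"
  obtains a where "0 < a" "a < 1" "(a - 1) ^ 3 + p * a = 0"
proof -
  have "\<exists>a\<ge>0. a \<le> 1 \<and> (a - 1) ^ 3 + p * a = 0"
    \<comment> \<open>The sign changes: the value is \<open>-1\<close> at \<open>0\<close> and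
      \<open>p > 0\<close> at \<open>1\<close>.\<close>
    by (rule IVT') (use assms in \<open>auto intro!: continuous_intros\<close>)
  then obtain a where a: "0 \<le> a" "a \<le> 1" "(a - 1) ^ 3 + p * a = 0"
    by blast
  moreover have "a \<noteq> 0" "a \<noteq> 1"
    using a(3) assms by auto
  ultimately show ?thesis
    by (intro that[of a]) auto
qed

text \<open>A negative discriminant makes the two roots non-real and conjugate, so their product
  \<open>d\<close> is the squared modulus of either.\<close>

lemma quadratic_root_norm:
  fixes s d :: real and r :: complex
  assumes disc: "s\<^sup>2 < 4 * d" and root: "r\<^sup>2 - of_real s * r + of_real d = 0"
  shows "(norm r)\<^sup>2 = d"
proof -
  have re: "(Re r)\<^sup>2 - (Im r)\<^sup>2 - s * Re r + d = 0"
    using arg_cong[OF root, of Re] by (simp add: power2_eq_square)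
  have im: "Im r * (2 * Re r - s) = 0"
    using arg_cong[OF root, of Im] by (simp add: power2_eq_square algebra_simps)
  \<comment> \<open>Completing the square at a real root would make the discriminant a
    square.\<close>
  have "Im r \<noteq> 0"
  proof
    assume "Im r = 0"
    with re have "(2 * Re r - s)\<^sup>2 = s\<^sup>2 - 4 * d"
      by (simp add: power2_eq_square algebra_simps)
    with disc show False
      by (smt (verit) zero_le_power2)
  qed
  with im have "s = 2 * Re r"
    by simp
  with re show ?thesis
    unfolding cmod_power2 by (simp add: power2_eq_square)
qed

text \<open>
  With \<open>a\<close> a root, the other factor is \<open>r\<^sup>2 - (3 - a) r + 1 / a\<close>; its discriminant is negative
  because \<open>a (3 - a)\<^sup>2 - 4 = (a - 1)\<^sup>2 (a - 4)\<close>.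
\<close>

lemma cubic_other_roots_outside:
  fixes a :: real and b c :: complex
  assumes a: "0 < a" "a < 1"
    and sum: "of_real a + b + c = 3" and prod: "of_real a * b * c = 1"
  shows "norm b > 1 \<and> norm c > 1"
proof -
  have bc: "b * c = of_real (1 / a)"
    using prod a by (simp add: field_simps)
  have "(a - 1)\<^sup>2 * (a - 4) < 0"
    using a by (intro mult_pos_neg) auto
  then have "(3 - a)\<^sup>2 * a < 4"
    by (simp add: power2_eq_square algebra_simps)
  then have disc: "(3 - a)\<^sup>2 < 4 * (1 / a)"
    using a by (simp add: field_simps)
  \<comment> \<open>Sum and product are symmetric in \<open>x\<close> and \<open>y\<close>, so this
    serves both \<open>b\<close> and \<open>c\<close>.\<close>
  have norm_sq: "(norm x)\<^sup>2 = 1 / a" if "x + y = of_real (3 - a)" "x * y = of_real (1 / a)" for x y :: complex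
  proof (rule quadratic_root_norm[OF disc])
    show "x\<^sup>2 - of_real (3 - a) * x + of_real (1 / a) = 0"
      unfolding that[symmetric] by (simp add: power2_eq_square algebra_simps)
  qed
  have "b + c = of_real (3 - a)"
    using sum by (simp add: algebra_simps)
  then have nb: "(norm b)\<^sup>2 = 1 / a" and nc: "(norm c)\<^sup>2 = 1 / a"
    using norm_sq[of b c] norm_sq[of c b] bc by (simp_all add: ac_simps)
  have "1 / a > 1\<^sup>2"
    using a by simp
  then show ?thesis
    using nb nc by (metis norm_ge_zero power_less_imp_less_base)
qed

lemma Vieta_cubic:
  fixes P :: "complex poly"
  assumes "lead_coeff P = 1" and "proots P = {#u, v, w#}"
  shows "u + v + w = - coeff P 2" and "u * v * w = - coeff P 0"
proof -
  have "P = smult (lead_coeff P) (\<Prod>x\<in>#proots P. [:- x, 1:])"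
    by (rule complex_poly_decompose_multiset[symmetric])
  also have "\<dots> = [:- (u * v * w), u * v + u * w + v * w, - (u + v + w), 1:]"
    using assms by (simp add: algebra_simps)
  finally show "u + v + w = - coeff P 2" and "u * v * w = - coeff P 0"
    by (simp_all add: numeral_2_eq_2)
qed

text \<open>A connected image in the reals contains every point between two of its values, so it
  cannot jump across \<open>c\<close>.\<close>

lemma connected_continuous_same_side:
  fixes f :: "'a::topological_space \<Rightarrow> real"
  assumes "connected S" "continuous_on S f" "\<And>x. x \<in> S \<Longrightarrow> f x \<noteq> c" "x \<in> S" "y \<in> S"
  shows "f x < c \<longleftrightarrow> f y < c"
proof -
  have conn: "connected (f ` S)"
    using assms by (intro connected_continuous_image)
  have "c \<notin> f ` S"
    using assms(3) by auto
  with connectedD_interval[OF conn, of "f x" "f y" c] connectedD_interval[OF conn, of "f y" "f x" c]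
  show ?thesis
    using assms(4,5) by force
qed

theorem theorem3p1:
  fixes U2 dx dt \<rho> :: real and l :: "nat \<Rightarrow> complex \<Rightarrow> complex"
  assumes "U2 > 0" and "dx > 0" and "dt > 0"
    and "\<rho> > 1"
    and "continuous_roots (mu U2 dx dt) \<rho> l"
  shows "\<exists>\<sigma>. \<sigma> permutes {1, 2, 3} \<and>
    (\<forall>\<theta>\<in>{0..<2 * pi}.
       norm (l (\<sigma> 1) (rcis \<rho> \<theta>)) < 1 \<and>
       norm (l (\<sigma> 2) (rcis \<rho> \<theta>)) > 1 \<and>
       norm (l (\<sigma> 3) (rcis \<rho> \<theta>)) > 1)"
proof -
  define \<mu> where "\<mu> = mu U2 dx dt"
  define f where "f k \<theta> = norm (l k (rcis \<rho> \<theta>))" for k \<theta>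
  have "\<mu> > 0"
    using assms by (simp add: \<mu>_def mu_def)
  have cont: "continuous_on {0..<2 * pi} (f k)" if "k \<in> {1, 2, 3}" for k
    unfolding f_def using assms(5) that by (intro continuous_on_norm) (auto simp: continuous_roots_def)
  have roots: "proots (char_cubic \<mu> (rcis \<rho> \<theta>))
      = {# l 1 (rcis \<rho> \<theta>), l 2 (rcis \<rho> \<theta>), l 3 (rcis \<rho> \<theta>) #}" if "\<theta> \<in> {0..<2 * pi}" for \<theta>
    using assms(5) that by (simp add: continuous_roots_def \<mu>_def)
  have off: "f k \<theta> \<noteq> 1" if "k \<in> {1, 2, 3}" "\<theta> \<in> {0..<2 * pi}" for k \<theta>
    unfolding f_def
  proof (rule cubic_root_not_on_circle)
    have "norm (rcis \<rho> \<theta>) > 1"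
      using assms(4) by simp
    from Re_Moebius_pos[OF this] show "Re (p_of \<mu> (rcis \<rho> \<theta>)) > 0"
      using \<open>\<mu> > 0\<close> by (simp add: p_of_def del: times_divide_eq_right flip: scaleR_conv_of_real)
    have "l k (rcis \<rho> \<theta>) \<in># proots (char_cubic \<mu> (rcis \<rho> \<theta>))"
      using that roots by auto
    then show "(l k (rcis \<rho> \<theta>) - 1) ^ 3 + p_of \<mu> (rcis \<rho> \<theta>) * l k (rcis \<rho> \<theta>) = 0"
      by (simp add: char_cubic_neq_0 poly_char_cubic)
  qed
  \<comment> \<open>The angle \<open>0\<close> belongs to the connected interval, so the side of the
    unit circle found there is kept at all angles.\<close>
  have inside: "f k \<theta> < 1" if "k \<in> {1, 2, 3}" "\<theta> \<in> {0..<2 * pi}" "f k 0 < 1" for k \<theta>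
    using connected_continuous_same_side[OF connected_Ico cont off, of k 0 \<theta>] that by auto
  have outside: "f k \<theta> > 1" if "k \<in> {1, 2, 3}" "\<theta> \<in> {0..<2 * pi}" "f k 0 > 1" for k \<theta>
    using connected_continuous_same_side[OF connected_Ico cont off, of k 0 \<theta>] off[of k \<theta>] that
    by auto

  \<comment> \<open>This is the value of \<open>p_of \<mu>\<close> at angle \<open>0\<close>, where
    \<open>z = \<rho>\<close> is real.\<close>
  define q where "q = \<mu> * ((\<rho> - 1) / (\<rho> + 1))"
  have "q > 0"
    using \<open>\<mu> > 0\<close> assms(4) by (simp add: q_def)
  then obtain a where a: "0 < a" "a < 1" "(a - 1) ^ 3 + q * a = 0"
    by (rule real_cubic_root_in_unit_interval)
  have rts: "proots (char_cubic \<mu> \<rho>) = {# l 1 \<rho>, l 2 \<rho>, l 3 \<rho> #}"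
    using roots[of 0] by simp
  have "poly (char_cubic \<mu> \<rho>) a = of_real ((a - 1) ^ 3 + q * a)"
    by (simp add: poly_char_cubic p_of_def q_def)
  then have "complex_of_real a \<in># proots (char_cubic \<mu> \<rho>)"
    using a(3) by (simp add: char_cubic_neq_0)
  then consider "l 1 \<rho> = a" | "l 2 \<rho> = a" | "l 3 \<rho> = a"
    unfolding rts by auto
  moreover have sum: "l 1 \<rho> + l 2 \<rho> + l 3 \<rho> = 3" and prod: "l 1 \<rho> * l 2 \<rho> * l 3 \<rho> = 1"
    using Vieta_cubic[OF _ rts] by (simp_all add: char_cubic_def numeral_2_eq_2)
  \<comment> \<open>The given numbering is arbitrary, so any of the three indices may carry the real
    root \<open>a\<close>.\<close>
  ultimately consider "f 1 0 < 1" "f 2 0 > 1" "f 3 0 > 1" | "f 2 0 < 1" "f 1 0 > 1" "f 3 0 > 1"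
    | "f 3 0 < 1" "f 2 0 > 1" "f 1 0 > 1"
  proof cases
    case 1
    then show ?thesis
      using cubic_other_roots_outside[OF a(1,2), of "l 2 \<rho>" "l 3 \<rho>"] sum prod a that(1)
      by (simp add: f_def)
  next
    case 2
    then show ?thesis
      using cubic_other_roots_outside[OF a(1,2), of "l 1 \<rho>" "l 3 \<rho>"] sum prod a that(2)
      by (simp add: f_def ac_simps)
  next
    case 3
    then show ?thesis
      using cubic_other_roots_outside[OF a(1,2), of "l 2 \<rho>" "l 1 \<rho>"] sum prod a that(3)
      by (simp add: f_def ac_simps)
  qed
  then show ?thesis
  proof cases
    case 1
    then show ?thesis
      using inside outside by (intro exI[of _ id]) (auto simp: permutes_id f_def)
  next
    case 2
    then show ?thesis
      using inside outside
      \<comment> \<open>Swapping the inner index with \<open>1\<close> suffices, as the two outer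
        roots may come in either order.\<close>
      by (intro exI[of _ "Transposition.transpose 1 2"])
        (auto simp: f_def Transposition.transpose_def intro!: permutes_swap_id)
  next
    case 3
    then show ?thesis
      using inside outside
      by (intro exI[of _ "Transposition.transpose 1 3"])
        (auto simp: f_def Transposition.transpose_def intro!: permutes_swap_id)
  qed
qed

end
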